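(* Let $\tau\in\{123,132\}$. Let $G$ be a graph whose connected components $G_1,\dots,G_k$ are each $\tau$-representable. Then $G$ is $\tau$-representable if and only if at most one of the components $G_1,\dots,G_k$ is not $\tau$-representable by a $2$-uniform word.
   Context: All graphs are simple. A word is a finite sequence of letters from a totally ordered alphabet; it is $2$-uniform if every letter occurring in it occurs exactly twice. Two letters $x,y$ alternate in a word $w$ if between any two occurrences of $x$ there is an occurrence of $y$ and between any two occurrences of $y$ there is an occurrence of $x$. A graph $G=(V,E)$ is represented by a word $w$ over $V$ if for all distinct $x,y\in V$, $x$ and $y$ alternate in $w$ if and only if $xy\in E$. A word contains a pattern $\tau$ (a permutation of length $m$) if some subsequence of length $m$ is order-isomorphic to $\tau$, and avoids $\tau$ otherwise. A graph is $\tau$-representable if, after labeling its vertices by distinct elements of a totally ordered set (any labeling may be chosen), it is represented by a $\tau$-avoiding word; it is $\tau$-representable by a $2$-uniform word if for some such labeling it is represented by a $\tau$-avoiding $2$-uniform word. *)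

theory Defs
  imports "Graph_Theory.Digraph_Component" "HOL-Library.Sublist"
begin

text \<open>
  Finite simple graphs are the symmetric digraphs of the locale \<^locale>\<open>graph\<close>: two vertices are
  adjacent iff the pair lies in \<^const>\<open>arcs_ends\<close>. For such a graph, strong connectivity is
  connectivity, so \<^const>\<open>pre_digraph.sccs\<close> is the set of its connected components, each as an
  induced subgraph.
\<close>

definition alternate :: "'a list \<Rightarrow> 'a \<Rightarrow> 'a \<Rightarrow> bool" where
  "alternate w x y \<longleftrightarrow>
     (\<forall>i j. i < j \<and> j < length w \<and> w ! i = x \<and> w ! j = x \<longrightarrow> (\<exists>k. i < k \<and> k < j \<and> w ! k = y)) \<and>
     (\<forall>i j. i < j \<and> j < length w \<and> w ! i = y \<and> w ! j = y \<longrightarrow> (\<exists>k. i < k \<and> k < j \<and> w ! k = x))"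

text \<open>
  As usual for word-representable graphs, a word over \<open>V\<close> representing a graph contains every
  letter of \<open>V\<close> at least once. Without this, the empty word would represent every complete graph.
\<close>

definition represents :: "'a list \<Rightarrow> ('a, 'b) pre_digraph \<Rightarrow> bool" where
  "represents w G \<longleftrightarrow> set w = verts G \<and>
     (\<forall>x\<in>verts G. \<forall>y\<in>verts G. x \<noteq> y \<longrightarrow> (alternate w x y \<longleftrightarrow> (x, y) \<in> arcs_ends G))"

definition two_uniform :: "'a list \<Rightarrow> bool" where
  "two_uniform w \<longleftrightarrow> (\<forall>x\<in>set w. count_list w x = 2)"

definition order_isomorphic :: "'a::linorder list \<Rightarrow> 'b::linorder list \<Rightarrow> bool" where
  "order_isomorphic u v \<longleftrightarrow> length u = length v \<and>
     (\<forall>i<length u. \<forall>j<length u. u ! i < u ! j \<longleftrightarrow> v ! i < v ! j)"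

definition avoids :: "'a::linorder list \<Rightarrow> nat list \<Rightarrow> bool" where
  "avoids w \<tau> \<longleftrightarrow> \<not> (\<exists>u. subseq u w \<and> order_isomorphic u \<tau>)"

text \<open>
  A labeling is an injection \<open>f\<close> of the vertices into a totally ordered set; as the vertex set is
  finite, labels in \<^typ>\<open>nat\<close> realize every order on it. The word is kept over the vertices,
  and \<open>map f w\<close> is the same word written in the labels.
\<close>

definition representable :: "nat list \<Rightarrow> ('a, 'b) pre_digraph \<Rightarrow> bool" where
  "representable \<tau> G \<longleftrightarrow>
     (\<exists>(f :: 'a \<Rightarrow> nat) w. inj_on f (verts G) \<and> represents w G \<and> avoids (map f w) \<tau>)"

definition two_uniform_representable :: "nat list \<Rightarrow> ('a, 'b) pre_digraph \<Rightarrow> bool" where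
  "two_uniform_representable \<tau> G \<longleftrightarrow>
     (\<exists>(f :: 'a \<Rightarrow> nat) w. inj_on f (verts G) \<and> represents w G \<and> two_uniform w \<and> avoids (map f w) \<tau>)"

end

theory Submission
  imports Defs
begin

text \<open>
  Two letters occurring at most once each alternate vacuously, so if \<open>G\<close> is represented by \<open>w\<close> then
  at most one component contains a letter occurring only once in \<open>w\<close>. It therefore suffices that a
  connected graph represented by a \<open>\<tau>\<close>-avoiding word in which every letter occurs at least twice is
  already represented by a 2-uniform one. If \<open>x\<close> occurs three times and is adjacent to \<open>y\<close> and
  \<open>z\<close>, then \<open>x\<close>, \<open>y\<close>, \<open>z\<close> occur in all six orders; hence \<open>x\<close> has a single neighbour \<open>y\<close>. If \<open>y\<close> also
  occurs three times, the graph is the single edge \<open>xy\<close>. Otherwise \<open>w\<close> restricted to \<open>x\<close> and \<open>y\<close>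
  is \<open>xyxyx\<close>, and one may delete all occurrences of \<open>x\<close> and replace a suitable occurrence of \<open>y\<close> by
  \<open>xyx\<close>. Conversely, words over distinct components are concatenated with decreasing labels, the
  one that is not 2-uniform (if any) coming first: \<open>y\<close> occurring twice in a row, without an \<open>x\<close>
  in between, prevents \<open>x\<close> and \<open>y\<close> from alternating.
\<close>

subsection \<open>Alternation\<close>

text \<open>Positions become factorisations of the word: \<open>i\<close> and \<open>j\<close> are
  the lengths of the parts before the two marked letters. As in the definition, the two occurrences
  need not be consecutive.\<close>

lemma alternate_iff_factors:
  "alternate w x y \<longleftrightarrow>
     (\<forall>P M Q. w = P @ x # M @ x # Q \<longrightarrow> y \<in> set M) \<and>
     (\<forall>P M Q. w = P @ y # M @ y # Q \<longrightarrow> x \<in> set M)"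
proof -
  have "(\<forall>i j. i < j \<and> j < length w \<and> w ! i = a \<and> w ! j = a \<longrightarrow> (\<exists>k. i < k \<and> k < j \<and> w ! k = b))
      \<longleftrightarrow> (\<forall>P M Q. w = P @ a # M @ a # Q \<longrightarrow> b \<in> set M)" (is "?L \<longleftrightarrow> ?R") for a b
  proof
    assume L: ?L
    show ?R
    proof (intro allI impI)
      fix P M Q assume w: "w = P @ a # M @ a # Q"
      have "w ! length P = a" "w ! (length P + Suc (length M)) = a"
        "length P + Suc (length M) < length w"
        by (simp_all add: w nth_append)
      then obtain k where k: "length P < k" "k < length P + Suc (length M)" "w ! k = b"
        using L by (metis less_add_same_cancel1 zero_less_Suc)
      then have "M ! (k - Suc (length P)) = b" "k - Suc (length P) < length M"
        by (auto simp: w nth_append nth_Cons' split: if_splits)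
      then show "b \<in> set M" by (auto simp: in_set_conv_nth)
    qed
  next
    assume R: ?R
    show ?L
    proof (intro allI impI)
      fix i j assume A: "i < j \<and> j < length w \<and> w ! i = a \<and> w ! j = a"
      define M where "M = drop (Suc i) (take j w)"
      have "take j w = take i w @ a # M"
        using A id_take_nth_drop[of i "take j w"] by (simp add: M_def min_def)
      then have "w = take i w @ a # M @ a # drop (Suc j) w"
        using A id_take_nth_drop[of j w] by simp
      then have "b \<in> set M" using R by blast
      then obtain m where "m < length M" "M ! m = b" by (auto simp: in_set_conv_nth)
      then have "i < Suc (i + m)" "Suc (i + m) < j" "w ! Suc (i + m) = b"
        using A by (auto simp: M_def)
      then show "\<exists>k. i < k \<and> k < j \<and> w ! k = b" by blast
    qed
  qed
  then show ?thesis unfolding alternate_def by simp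
qed

lemma not_distinct_adj_iff: "\<not> distinct_adj xs \<longleftrightarrow> (\<exists>us a vs. xs = us @ a # a # vs)"
proof
  show "\<not> distinct_adj xs \<Longrightarrow> \<exists>us a vs. xs = us @ a # a # vs"
  proof (induction xs)
    case (Cons b xs)
    show ?case
    proof (cases "distinct_adj xs")
      case True
      then obtain ys where "xs = b # ys" using Cons.prems by (cases xs) auto
      then have "b # xs = [] @ b # b # ys" by simp
      then show ?thesis by blast
    next
      case False
      then show ?thesis using Cons.IH by (metis append_Cons)
    qed
  qed simp
qed (auto simp: distinct_adj_append_iff)

lemma filter_eq_appendD:
  "filter S w = us @ vs \<Longrightarrow> \<exists>u v. w = u @ v \<and> filter S u = us \<and> filter S v = vs"
proof (induction us arbitrary: w)
  case Nil
  then show ?case by (metis append_Nil filter.simps(1))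
next
  case (Cons a us)
  then obtain u w' where w: "w = u @ a # w'" "\<forall>z\<in>set u. \<not> S z" "S a" "filter S w' = us @ vs"
    by (auto simp: filter_eq_Cons_iff)
  then obtain u' v where "w' = u' @ v" "filter S u' = us" "filter S v = vs"
    using Cons.IH by blast
  with w have "w = (u @ a # u') @ v \<and> filter S (u @ a # u') = a # us \<and> filter S v = vs"
    by (auto simp: filter_empty_conv)
  then show ?case by blast
qed

lemma distinct_adj_all_eq:
  "distinct_adj xs \<Longrightarrow> \<forall>z\<in>set xs. z = a \<Longrightarrow> xs = [] \<or> xs = [a]"
  by (cases xs; cases "tl xs") auto

text \<open>Two occurrences of one letter with the other missing in between leave only copies of the
  first letter in that stretch of the restriction to \<open>x\<close> and \<open>y\<close>, hence
  two equal neighbours; and equal neighbours come from such a stretch. On explicit words this makes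
  alternation a computation.\<close>

lemma alternate_iff_distinct_adj:
  assumes "x \<noteq> y"
  shows "alternate w x y \<longleftrightarrow> distinct_adj (filter (\<lambda>z. z = x \<or> z = y) w)" (is "_ \<longleftrightarrow> distinct_adj (?F w)")
proof
  show "distinct_adj (?F w)" if alt: "alternate w x y"
  proof (rule ccontr)
    assume "\<not> distinct_adj (?F w)"
    then obtain us a vs where "?F w = us @ a # a # vs" by (auto simp: not_distinct_adj_iff)
    then obtain P R where w: "w = P @ R" and "?F R = a # a # vs" using filter_eq_appendD by blast
    from filter_eq_ConsD[OF this(2)] obtain U S
      where R: "R = U @ a # S" and a: "a = x \<or> a = y" and "a # vs = ?F S" by blast
    from filter_eq_ConsD[OF this(3)[symmetric]] obtain M Q
      where S: "S = M @ a # Q" and M: "x \<notin> set M" "y \<notin> set M" by blast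
    have "w = (P @ U) @ a # M @ a # Q" unfolding w R S by simp
    then show False using alt M a unfolding alternate_iff_factors by blast
  qed
next
  assume d: "distinct_adj (?F w)"
  have *: "b \<in> set M" if w: "w = P @ a # M @ a # Q" and ab: "{a, b} = {x, y}" for P M Q a b
  proof (rule ccontr)
    assume b: "b \<notin> set M"
    have a: "a = x \<or> a = y" and xy: "x = a \<and> y = b \<or> x = b \<and> y = a"
      using ab by (auto simp: doubleton_eq_iff)
    have "?F w = ?F P @ (a # ?F M @ [a]) @ ?F Q" using w a by auto
    then have "distinct_adj (a # ?F M @ [a])"
      using d by (simp only: distinct_adj_append_iff)
    moreover have "\<forall>z\<in>set (a # ?F M @ [a]). z = a" using b xy by auto
    ultimately show False using distinct_adj_all_eq[of "a # ?F M @ [a]" a] by simp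
  qed
  show "alternate w x y" unfolding alternate_iff_factors using * by blast
qed

lemma alternate_commute: "alternate w x y \<longleftrightarrow> alternate w y x"
  unfolding alternate_def by blast

lemma alternate_filter:
  assumes "x \<noteq> y" "S x" "S y"
  shows "alternate (filter S w) x y \<longleftrightarrow> alternate w x y"
proof -
  have "filter (\<lambda>z. z = x \<or> z = y) (filter S w) = filter (\<lambda>z. z = x \<or> z = y) w"
    using assms by (auto intro: filter_cong)
  then show ?thesis using assms by (simp add: alternate_iff_distinct_adj)
qed

subsection \<open>Patterns of length three\<close>

lemma order_isomorphic_123: "order_isomorphic [p, q, r] [1, 2, 3::nat] \<longleftrightarrow> p < q \<and> q < r"
  by (auto simp: order_isomorphic_def less_Suc_eq numeral_3_eq_3)

lemma order_isomorphic_132: "order_isomorphic [p, q, r] [1, 3, 2::nat] \<longleftrightarrow> p < r \<and> r < q"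
  by (auto simp: order_isomorphic_def less_Suc_eq numeral_3_eq_3)

lemmas order_isomorphic_3 =
  order_isomorphic_123 order_isomorphic_123[unfolded One_nat_def]
  order_isomorphic_132 order_isomorphic_132[unfolded One_nat_def]

lemma subseq_map_iff: "subseq u (map f w) \<longleftrightarrow> (\<exists>v. subseq v w \<and> u = map f v)"
  by (auto simp: subseq_conv_nths nths_map)

text \<open>Only words of length three can match the pattern, so avoidance becomes a condition on
  triples of vertices, with labels entering only in the comparison.\<close>

lemma avoids_map_iff:
  assumes "length \<tau> = 3"
  shows "avoids (map f w) \<tau> \<longleftrightarrow>
    (\<forall>a b c. subseq [a, b, c] w \<longrightarrow> \<not> order_isomorphic [f a, f b, f c] \<tau>)"
proof -
  have "\<exists>a b c. v = [a, b, c]" if "order_isomorphic (map f v) \<tau>" for v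
    using that assms by (auto simp: order_isomorphic_def length_Suc_conv numeral_3_eq_3)
  then show ?thesis unfolding avoids_def subseq_map_iff by fastforce
qed

lemma avoids_map_123_iff:
  "avoids (map f w) [1, 2, 3] \<longleftrightarrow> (\<forall>a b c. subseq [a, b, c] w \<longrightarrow> \<not> (f a < f b \<and> f b < f c))"
  using avoids_map_iff[of "[1, 2, 3]" f w] by (simp add: order_isomorphic_3)

lemma avoids_map_132_iff:
  "avoids (map f w) [1, 3, 2] \<longleftrightarrow> (\<forall>a b c. subseq [a, b, c] w \<longrightarrow> \<not> (f a < f c \<and> f c < f b))"
  using avoids_map_iff[of "[1, 3, 2]" f w] by (simp add: order_isomorphic_3)

section \<open>Subsequences of length two and three in words built from blocks\<close>

lemma subseq_append_2:
  "subseq [a, b] (u @ v) \<longleftrightarrow> subseq [a, b] u \<or> a \<in> set u \<and> b \<in> set v \<or> subseq [a, b] v"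
  by (induction u) (auto simp: subseq_singleton_left dest: subseq_Cons')

lemma subseq_append_3:
  "subseq [a, b, c] (u @ v) \<longleftrightarrow>
     subseq [a, b, c] u \<or> subseq [a, b] u \<and> c \<in> set v \<or> a \<in> set u \<and> subseq [b, c] v \<or> subseq [a, b, c] v"
  by (induction u) (auto simp: subseq_singleton_left subseq_append_2 dest: subseq_Cons')

lemma subseq_Cons_2:
  "subseq [a, b] (z # v) \<longleftrightarrow> a = z \<and> b \<in> set v \<or> subseq [a, b] v"
  by (auto simp: subseq_singleton_left dest: subseq_Cons')

lemma subseq_Cons_3:
  "subseq [a, b, c] (z # v) \<longleftrightarrow> a = z \<and> subseq [b, c] v \<or> subseq [a, b, c] v"
  by (auto dest: subseq_Cons')

lemma subseq_2_imp_set: "subseq [a, b] v \<Longrightarrow> a \<in> set v \<and> b \<in> set v"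
  by (induction v) (auto simp: subseq_Cons_2 simp del: subseq_Cons2_iff)

lemma subseq_3_imp_set: "subseq [a, b, c] v \<Longrightarrow> a \<in> set v \<and> b \<in> set v \<and> c \<in> set v"
  by (induction v) (auto simp: subseq_Cons_3 simp del: subseq_Cons2_iff dest: subseq_2_imp_set)

lemma not_subseq_short:
  "a \<notin> set v \<Longrightarrow> \<not> subseq [a, b] v" "b \<notin> set v \<Longrightarrow> \<not> subseq [a, b] v"
  "a \<notin> set v \<Longrightarrow> \<not> subseq [a, b, c] v" "b \<notin> set v \<Longrightarrow> \<not> subseq [a, b, c] v"
  "c \<notin> set v \<Longrightarrow> \<not> subseq [a, b, c] v"
  using subseq_2_imp_set subseq_3_imp_set by metis+

lemmas subseq_short = subseq_append_2 subseq_append_3 subseq_Cons_2 subseq_Cons_3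

subsection \<open>Letters occurring three times\<close>

text \<open>The graph is reduced to a vertex set and a relation. Since \<open>E\<close> may contain
  pairs outside \<open>V\<close>, all components can share the relation
  \<open>arcs_ends G\<close>.\<close>

definition represents_on :: "'a list \<Rightarrow> 'a set \<Rightarrow> ('a \<times> 'a) set \<Rightarrow> bool" where
  "represents_on w V E \<longleftrightarrow> set w = V \<and>
     (\<forall>x\<in>V. \<forall>y\<in>V. x \<noteq> y \<longrightarrow> (alternate w x y \<longleftrightarrow> (x, y) \<in> E))"

lemma split_at_first:
  assumes "Suc n \<le> count_list w x"
  obtains P R where "w = P @ x # R" "x \<notin> set P" "n \<le> count_list R x"
proof -
  have "x \<in> set w" using assms by (metis count_notin not_less_eq_eq zero_le)
  then obtain P R where w: "w = P @ x # R" "x \<notin> set P" by (metis split_list_first)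
  with assms have "n \<le> count_list R x" by simp
  with w that show thesis by blast
qed

text \<open>Alternation forces a \<open>y\<close> between the two occurrences of \<open>x\<close>,
  and a second \<open>y\<close> there would need another \<open>x\<close> in between.\<close>

lemma alternate_unique_between:
  assumes "x \<noteq> y" "alternate (P @ x # M @ x # Q) x y" "x \<notin> set M"
  obtains A B where "M = A @ y # B" "y \<notin> set A" "y \<notin> set B"
proof -
  have "y \<in> set M" using assms(2) unfolding alternate_iff_factors by blast
  then obtain A B where M: "M = A @ y # B" "y \<notin> set A" by (metis split_list_first)
  have "y \<notin> set B"
  proof
    assume "y \<in> set B"
    then obtain B1 B2 where "B = B1 @ y # B2" by (metis split_list)
    then have "P @ x # M @ x # Q = (P @ x # A) @ y # B1 @ y # (B2 @ x # Q)" using M by simp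
    then have "x \<in> set B1" using assms(2) unfolding alternate_iff_factors by blast
    then show False using assms(3) M \<open>B = _\<close> by simp
  qed
  with M that show thesis by blast
qed

text \<open>These are the first three occurrences; \<open>Q\<close> may contain more.\<close>

lemma three_occurrences:
  assumes "3 \<le> count_list w x"
  obtains P M N Q where "w = P @ x # M @ x # N @ x # Q" "x \<notin> set P \<union> set M \<union> set N"
proof -
  obtain P R where w: "w = P @ x # R" "x \<notin> set P" "2 \<le> count_list R x"
    using split_at_first[of 2 w x] assms by auto
  obtain M S where R: "R = M @ x # S" "x \<notin> set M" "1 \<le> count_list S x"
    using split_at_first[of 1 R x] w(3) by auto
  obtain N Q where S: "S = N @ x # Q" "x \<notin> set N"
    using split_at_first[of 0 S x] R(3) by auto
  show thesis by (rule that[of P M N Q]) (use w R S in auto)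
qed

text \<open>The two gaps between the first three occurrences of \<open>x\<close> use up both
  occurrences of \<open>y\<close>. A fourth \<open>x\<close> would need a third \<open>y\<close>, so
  the restriction to \<open>x\<close> and \<open>y\<close> is exactly \<open>xyxyx\<close>.\<close>

lemma alternate_three_two_occurrences:
  assumes "x \<noteq> y" "alternate w x y" "3 \<le> count_list w x" "count_list w y \<le> 2"
  obtains P A B C D Q where "w = P @ x # A @ y # B @ x # C @ y # D @ x # Q"
    "{x, y} \<inter> (set P \<union> set A \<union> set B \<union> set C \<union> set D \<union> set Q) = {}"
proof -
  obtain P M N Q where PMN: "w = P @ x # M @ x # N @ x # Q" "x \<notin> set P \<union> set M \<union> set N"
    by (rule three_occurrences[OF assms(3)])
  obtain A B where M: "M = A @ y # B" "y \<notin> set A" "y \<notin> set B"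
    using alternate_unique_between[of x y P M "N @ x # Q"] assms(1,2) PMN by auto
  obtain C D where N: "N = C @ y # D" "y \<notin> set C" "y \<notin> set D"
    using alternate_unique_between[of x y "P @ x # M" N Q] assms(1,2) PMN by auto
  have w: "w = P @ x # A @ y # B @ x # C @ y # D @ x # Q"
    "x \<notin> set P \<union> set A \<union> set B \<union> set C \<union> set D" "y \<notin> set A \<union> set B \<union> set C \<union> set D"
    using PMN M N by auto
  have y: "y \<notin> set P" "y \<notin> set Q"
    using assms(1,4) w(1) by (auto simp: count_list_0_iff)
  have "x \<notin> set Q"
  proof
    assume "x \<in> set Q"
    then obtain Q1 Q2 where Q: "Q = Q1 @ x # Q2" by (metis split_list)
    then have "w = (P @ x # A @ y # B @ x # C @ y # D) @ x # Q1 @ x # Q2" using w(1) by simp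
    then have "y \<in> set Q1" using assms(2) unfolding alternate_iff_factors by blast
    then show False using y Q by simp
  qed
  with w y that show thesis by blast
qed

text \<open>Let \<open>a\<close>, \<open>b\<close>, \<open>c\<close> be the three letters by
  increasing label. Then \<open>[a, b, c]\<close> is an occurrence of 123 and
  \<open>[a, c, b]\<close> one of 132, and both are among the six orders.\<close>

lemma contains_patterns:
  fixes f :: "'a \<Rightarrow> nat"
  assumes "\<tau> \<in> {[1, 2, 3], [1, 3, 2]}" "distinct [f x, f y, f z]"
    and "\<forall>u \<in> {[x,y,z], [x,z,y], [y,x,z], [y,z,x], [z,x,y], [z,y,x]}. subseq u w"
  shows "\<not> avoids (map f w) \<tau>"
proof -
  let ?S = "{[x,y,z], [x,z,y], [y,x,z], [y,z,x], [z,x,y], [z,y,x]}"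
  consider "f x < f y \<and> f y < f z" | "f x < f z \<and> f z < f y" | "f y < f x \<and> f x < f z"
    | "f y < f z \<and> f z < f x" | "f z < f x \<and> f x < f y" | "f z < f y \<and> f y < f x"
    using assms(2) by (auto simp: neq_iff)
  then obtain a b c where abc: "f a < f b" "f b < f c" and "[a, b, c] \<in> ?S" "[a, c, b] \<in> ?S"
    by cases (blast intro: that)+
  with assms(3) have "subseq [a, b, c] w" "subseq [a, c, b] w" by blast+
  moreover have "order_isomorphic [f a, f b, f c] \<tau> \<or> order_isomorphic [f a, f c, f b] \<tau>"
    using abc assms(1) by (auto simp: order_isomorphic_3)
  moreover have "length \<tau> = 3" using assms(1) by auto
  ultimately show ?thesis by (auto simp: avoids_map_iff)
qed

text \<open>Both gaps \<open>M\<close> and \<open>N\<close> between occurrences of \<open>x\<close>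
  contain \<open>y\<close> as well as \<open>z\<close>. Taking one of them from each gap and
  \<open>x\<close> before, between or after them gives all six orders.\<close>

lemma leaf_if_three_occurrences:
  fixes f :: "'a \<Rightarrow> nat"
  assumes "\<tau> \<in> {[1, 2, 3], [1, 3, 2]}" "avoids (map f w) \<tau>" "inj_on f (set w)"
    and "3 \<le> count_list w x" "x \<noteq> y" "x \<noteq> z" "alternate w x y" "alternate w x z"
  shows "y = z"
proof (rule ccontr)
  assume "y \<noteq> z"
  obtain P M N Q where w: "w = P @ x # M @ x # N @ x # Q"
    by (rule three_occurrences[OF assms(4)])
  then have w2: "w = (P @ x # M) @ x # N @ x # Q" by simp
  have M: "y \<in> set M" "z \<in> set M"
    using w assms(7,8) unfolding alternate_iff_factors by blast+
  have N: "y \<in> set N" "z \<in> set N"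
    using w2 assms(7,8) unfolding alternate_iff_factors by blast+
  have "distinct [f x, f y, f z]"
    using assms(3,5,6) \<open>y \<noteq> z\<close> M unfolding w by (auto dest!: inj_onD)
  moreover have "\<forall>u \<in> {[x,y,z], [x,z,y], [y,x,z], [y,z,x], [z,x,y], [z,y,x]}. subseq u w"
    using M N unfolding w by (simp add: subseq_short del: subseq_Cons2_iff)
  ultimately have "\<not> avoids (map f w) \<tau>" by (rule contains_patterns[OF assms(1)])
  then show False using assms(2) by blast
qed

section \<open>Moving the occurrences of a leaf next to one occurrence of its neighbour\<close>

text \<open>A subsequence without \<open>x\<close> survives the deletion of \<open>x\<close>. This
  settles all triples without \<open>x\<close> after a relocation, which changes only the places of
  \<open>x\<close>.\<close>

lemma subseq_if_removeAll_eq: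
  assumes "subseq u w'" "x \<notin> set u" "removeAll x w' = removeAll x w"
  shows "subseq u w"
proof -
  have "subseq (removeAll x u) (removeAll x w')"
    using assms(1) by (simp add: removeAll_filter_not_eq)
  then show ?thesis
    using assms(2,3) by (metis removeAll_id removeAll_filter_not_eq subseq_filter_left subseq_order.order_trans)
qed

text \<open>A letter of \<open>P\<close> or \<open>A\<close> with a label below that of
  \<open>x\<close> would form either pattern with \<open>x\<close> and \<open>y\<close>, because
  these follow it in both orders in \<open>w\<close>. So in the new word \<open>x\<close> can only
  be the first letter of an occurrence, and then the first \<open>x\<close> of \<open>w\<close> can
  replace it.\<close>

lemma relocate_up:
  fixes f :: "'a \<Rightarrow> nat"
  assumes \<tau>: "\<tau> \<in> {[1, 2, 3], [1, 3, 2]}"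
    and w: "w = P @ x # A @ y # B @ x # C @ y # D @ x # Q"
    and xy: "{x, y} \<inter> (set P \<union> set A \<union> set B \<union> set C \<union> set D \<union> set Q) = {}"
    and av: "avoids (map f w) \<tau>"
    and less: "f x < f y"
  shows "avoids (map f (P @ A @ x # y # x # B @ C @ y # D @ Q)) \<tau>"
proof -
  let ?w = "P @ A @ x # y # x # B @ C @ y # D @ Q"
  have len: "length \<tau> = 3" using \<tau> by auto
  have iso: "order_isomorphic [p, q, r] \<tau> \<Longrightarrow> p < q \<and> p < r \<and> q \<noteq> r" for p q r :: nat
    using \<tau> by (auto simp: order_isomorphic_3)
  have no: "subseq [a, b, c] w \<Longrightarrow> \<not> order_isomorphic [f a, f b, f c] \<tau>" for a b c
    using av len by (simp add: avoids_map_iff)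
  have low: "f x \<le> f a" if "a \<in> set P \<union> set A" for a
  proof (rule ccontr)
    assume "\<not> f x \<le> f a"
    then have "order_isomorphic [f a, f x, f y] \<tau> \<or> order_isomorphic [f a, f y, f x] \<tau>"
      using \<tau> less by (auto simp: order_isomorphic_3)
    moreover have "subseq [a, x, y] w" "subseq [a, y, x] w"
      using that unfolding w by (auto simp: subseq_short simp del: subseq_Cons2_iff)
    ultimately show False using no by blast
  qed
  have "\<not> order_isomorphic [f a, f b, f c] \<tau>" if sub: "subseq [a, b, c] ?w" for a b c
  proof
    assume o: "order_isomorphic [f a, f b, f c] \<tau>"
    then have abc: "f a < f b" "f a < f c" "f b \<noteq> f c" using iso[OF o] by simp_all
    then have "a \<noteq> b" "a \<noteq> c" "b \<noteq> c" by auto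
    then consider "a = x" "b \<noteq> x" "c \<noteq> x" | "b = x \<or> c = x" "a \<noteq> x" | "x \<notin> {a, b, c}"
      by blast
    then show False
    proof cases
      case 1
      have "subseq [x, b, c] w"
        using sub 1 xy unfolding w by (auto simp: subseq_short simp del: subseq_Cons2_iff)
      then show False using no o 1 by blast
    next
      case 2
      then have "a \<in> set P \<union> set A \<union> {y}"
        using sub xy less by (auto simp: subseq_short simp del: subseq_Cons2_iff
          dest: subseq_2_imp_set subseq_3_imp_set)
      then show False using 2 low abc less by fastforce
    next
      case 3
      then have "subseq [a, b, c] w"
        using subseq_if_removeAll_eq[OF sub, of x w] unfolding w by simp
      then show False using no o by blast
    qed
  qed
  then show ?thesis unfolding avoids_map_iff[OF len] by blast
qed

text \<open>This mirrors the previous argument under reversal of words and of the order, which fixes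
  123 but not 132. Letters after the second \<open>y\<close> have labels at most that of
  \<open>x\<close>, so \<open>x\<close> can only end an occurrence, and then the last
  \<open>x\<close> of \<open>w\<close> can replace it.\<close>

lemma relocate_down_123:
  fixes f :: "'a \<Rightarrow> nat"
  assumes w: "w = P @ x # A @ y # B @ x # C @ y # D @ x # Q"
    and xy: "{x, y} \<inter> (set P \<union> set A \<union> set B \<union> set C \<union> set D \<union> set Q) = {}"
    and av: "avoids (map f w) [1, 2, 3]"
    and less: "f y < f x"
  shows "avoids (map f (P @ A @ y # B @ C @ x # y # x # D @ Q)) [1, 2, 3]"
proof -
  let ?w = "P @ A @ y # B @ C @ x # y # x # D @ Q"
  have no: "subseq [a, b, c] w \<Longrightarrow> \<not> (f a < f b \<and> f b < f c)" for a b c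
    using av unfolding avoids_map_123_iff by blast
  have high: "f c \<le> f x" if "c \<in> set D \<union> set Q" for c
  proof -
    have "subseq [y, x, c] w"
      using that unfolding w by (auto simp: subseq_short simp del: subseq_Cons2_iff)
    then show ?thesis using no less by fastforce
  qed
  have "\<not> (f a < f b \<and> f b < f c)" if sub: "subseq [a, b, c] ?w" for a b c
  proof
    assume abc: "f a < f b \<and> f b < f c"
    then have "a \<noteq> b" "a \<noteq> c" "b \<noteq> c" by auto
    then consider "c = x" "a \<noteq> x" "b \<noteq> x" | "a = x \<or> b = x" "c \<noteq> x" | "x \<notin> {a, b, c}"
      by blast
    then show False
    proof cases
      case 1
      have "subseq [a, b, x] w"
        using sub 1 xy unfolding w by (auto simp: subseq_short simp del: subseq_Cons2_iff)
      then show False using no abc 1 by blast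
    next
      case 2
      then have "c \<in> set D \<union> set Q \<union> {y}"
        using sub xy less by (auto simp: subseq_short simp del: subseq_Cons2_iff
          dest: subseq_2_imp_set subseq_3_imp_set)
      then show False using 2 high abc less by fastforce
    next
      case 3
      then have "subseq [a, b, c] w"
        using subseq_if_removeAll_eq[OF sub, of x w] unfolding w by simp
      then show False using no abc by blast
    qed
  qed
  then show ?thesis unfolding avoids_map_123_iff by blast
qed

text \<open>
  Here \<open>x\<close> has to be relabelled: its new label is the immediate successor of the label of \<open>y\<close>.
\<close>

lemma relocate_down_132:
  fixes f :: "'a \<Rightarrow> nat"
  assumes w: "w = P @ x # A @ y # B @ x # C @ y # D @ x # Q"
    and xy: "{x, y} \<inter> (set P \<union> set A \<union> set B \<union> set C \<union> set D \<union> set Q) = {}"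
    and av: "avoids (map f w) [1, 3, 2]"
    and inj: "inj_on f (set w)"
    and less: "f y < f x"
  defines "g \<equiv> \<lambda>z. if z = x then 2 * f y + 1 else 2 * f z"
  shows "avoids (map g (P @ A @ x # y # x # B @ C @ y # D @ Q)) [1, 3, 2]"
proof -
  let ?w = "P @ A @ x # y # x # B @ C @ y # D @ Q"
  have no: "subseq [a, b, c] w \<Longrightarrow> \<not> (f a < f c \<and> f c < f b)" for a b c
    using av unfolding avoids_map_132_iff by blast
  \<comment> \<open>A smaller label would make \<open>[a, x, y]\<close> an occurrence of 132;
    equality is excluded by injectivity.\<close>
  have low: "f y < f a" if "a \<in> set P \<union> set A" for a
  proof -
    have "subseq [a, x, y] w"
      using that unfolding w by (auto simp: subseq_short simp del: subseq_Cons2_iff)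
    then have "f y \<le> f a" using no less by fastforce
    moreover have "f y \<noteq> f a" using inj that xy unfolding w by (auto dest!: inj_onD)
    ultimately show ?thesis by simp
  qed
  have "\<not> (g a < g c \<and> g c < g b)" if sub: "subseq [a, b, c] ?w" for a b c
  proof
    assume abc: "g a < g c \<and> g c < g b"
    then have "a \<noteq> b" "a \<noteq> c" "b \<noteq> c" by auto
    then consider "a = x" "b \<noteq> x" "c \<noteq> x" | "b = x" "a \<noteq> x" "c \<noteq> x" | "c = x" "a \<noteq> x" "b \<noteq> x" | "x \<notin> {a, b, c}"
      by blast
    then show False
    proof cases
      case 1
      then have *: "f y < f c \<and> f c < f b" using abc by (auto simp: g_def)
      \<comment> \<open>The aim is to let \<open>y\<close> take over the role of \<open>x\<close>:
        both other labels exceed that of \<open>y\<close>, and both letters come after the first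
        \<open>y\<close> in \<open>w\<close>.\<close>
      then have "b \<noteq> y" "c \<noteq> y" by auto
      then have "subseq [b, c] (B @ C @ y # D @ Q)"
        using sub 1 xy less by (auto simp: subseq_short not_subseq_short simp del: subseq_Cons2_iff)
      then have "subseq [b, c] (B @ x # C @ y # D @ x # Q)"
        by (simp add: subseq_short del: subseq_Cons2_iff) blast
      then have "subseq [y, b, c] w"
        unfolding w by (simp add: subseq_short del: subseq_Cons2_iff)
      then show False using no * by blast
    next
      case 2
      then have *: "f a < f c" "f c \<le> f y" using abc by (auto simp: g_def)
      have "a \<in> set P \<union> set A \<union> {y}"
        using 2 sub xy less by (auto simp: subseq_short simp del: subseq_Cons2_iff
          dest: subseq_2_imp_set subseq_3_imp_set)
      then show False using * low by fastforce
    next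
      case 3
      then have *: "f a \<le> f y" "f y < f b" using abc by (auto simp: g_def)
      \<comment> \<open>The choice \<open>a = y\<close> fails, since in the new word nothing lies
        between the first \<open>y\<close> and the last \<open>x\<close> that could serve as
        \<open>b\<close>.\<close>
      have "a \<in> set P \<union> set A"
        using 3 * sub xy less by (auto simp: subseq_short simp del: subseq_Cons2_iff
          dest: subseq_2_imp_set subseq_3_imp_set)
      then show False using * low by fastforce
    next
      case 4
      then have "subseq [a, b, c] w" 
        using subseq_if_removeAll_eq[OF sub, of x w] unfolding w by simp
      moreover have "f a < f c \<and> f c < f b" using abc 4 by (auto simp: g_def)
      ultimately show False using no by blast
    qed
  qed
  then show ?thesis unfolding avoids_map_132_iff by blast
qed

text \<open>Pairs without \<open>x\<close> see the same restriction as before. Only \<open>y\<close>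
  separates the two occurrences of \<open>x\<close>, so \<open>x\<close> alternates with no third
  letter; the one remaining \<open>y\<close> lies outside \<open>xyx\<close>, which gives
  \<open>yxyx\<close> or \<open>xyxy\<close>.\<close>

lemma relocate_represents_on:
  assumes rep: "represents_on w V E"
    and alt: "alternate w x y" "x \<noteq> y" "\<And>z. z \<noteq> x \<Longrightarrow> alternate w x z \<Longrightarrow> z = y"
    and w': "w' = P @ x # y # x # Q" "x \<notin> set P \<union> set Q" "count_list w' y = 2"
    and eq: "removeAll x w' = removeAll x w" and x: "x \<in> set w"
  shows "represents_on w' V E"
proof -
  have "x \<in> set w'" using w'(1) by simp
  moreover have "set (removeAll x w') = set (removeAll x w)" using eq by simp
  ultimately have "set w' = set w" using x by (simp add: insert_absorb) blast
  then have set: "set w' = V" using rep by (simp add: represents_on_def)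
  have rest: "alternate w' u v \<longleftrightarrow> alternate w u v" if "u \<noteq> v" "u \<noteq> x" "v \<noteq> x" for u v
    using alternate_filter[of u v "\<lambda>z. x \<noteq> z"] that eq by (metis removeAll_filter_not_eq)
  have xz: "\<not> alternate w' x z" if "z \<noteq> x" "z \<noteq> y" for z
    using that by (auto simp: alternate_iff_distinct_adj w' distinct_adj_append_iff)
  have "alternate w' x y"
  proof -
    have F: "filter (\<lambda>z. z = x \<or> z = y) R = filter (\<lambda>z. z = y) R" if "x \<notin> set R" for R
      using that by (auto intro: filter_cong)
    have "count_list P y = 0 \<and> count_list Q y = 1 \<or> count_list P y = 1 \<and> count_list Q y = 0"
      using w'(1,3) alt(2) by auto
    moreover have "filter (\<lambda>z. z = y) R = replicate (count_list R y) y" for R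
      by (induction R) auto
    ultimately show ?thesis
      using alt(2) w'(1,2) F[of P] F[of Q] by (auto simp: alternate_iff_distinct_adj)
  qed
  then have "alternate w' x z \<longleftrightarrow> alternate w x z" if "z \<noteq> x" for z
    using that xz alt by metis
  then have "alternate w' u v \<longleftrightarrow> alternate w u v" if "u \<noteq> v" for u v
    using that rest alternate_commute by metis
  then show ?thesis using rep set by (simp add: represents_on_def)
qed

lemma avoids_map_if_two_letters:
  fixes f :: "'a \<Rightarrow> nat"
  assumes "\<tau> \<in> {[1, 2, 3], [1, 3, 2]}" "set w \<subseteq> {x, y}"
  shows "avoids (map f w) \<tau>"
proof -
  have *: "a = b \<or> a = c \<or> b = c" if "subseq [a, b, c] w" for a b c
    using subseq_3_imp_set[OF that] assms(2) by blast
  show ?thesis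
    using assms(1)
  proof (elim insertE emptyE)
    assume "\<tau> = [1, 2, 3]"
    then show ?thesis using * by (simp only: avoids_map_123_iff) (metis less_imp_not_less less_irrefl less_trans)
  next
    assume "\<tau> = [1, 3, 2]"
    then show ?thesis using * by (simp only: avoids_map_132_iff) (metis less_imp_not_less less_irrefl less_trans)
  qed
qed

text \<open>If the label of \<open>x\<close> is the smaller one, \<open>x\<close> moves around the
  first \<open>y\<close>. Otherwise it moves around the second \<open>y\<close> for 123, and around
  the first \<open>y\<close> with a new label for 132.\<close>

lemma relocate_leaf:
  fixes f :: "'a \<Rightarrow> nat"
  assumes \<tau>: "\<tau> \<in> {[1, 2, 3], [1, 3, 2]}" and av: "avoids (map f w) \<tau>" and inj: "inj_on f V"
    and rep: "represents_on w V E" and x: "3 \<le> count_list w x"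
    and y: "x \<noteq> y" "alternate w x y" "count_list w y = 2"
  obtains g w' where "inj_on (g :: 'a \<Rightarrow> nat) V" "avoids (map g w') \<tau>" "represents_on w' V E"
    "count_list w' x = 2" "removeAll x w' = removeAll x w"
proof -
  obtain P A B C D Q where w: "w = P @ x # A @ y # B @ x # C @ y # D @ x # Q"
    and xy: "{x, y} \<inter> (set P \<union> set A \<union> set B \<union> set C \<union> set D \<union> set Q) = {}"
    using alternate_three_two_occurrences[OF y(1,2) x] y(3) by (metis order_refl)
  have V: "set w = V" using rep by (simp add: represents_on_def)
  then have injw: "inj_on f (set w)" using inj by simp
  have leaf: "z = y" if "z \<noteq> x" "alternate w x z" for z
    using leaf_if_three_occurrences[OF \<tau> av injw x y(1) _ y(2) that(2)] that(1) by simp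
  let ?u = "P @ A @ x # y # x # B @ C @ y # D @ Q" and ?d = "P @ A @ y # B @ C @ x # y # x # D @ Q"
  have *: "represents_on w' V E \<and> count_list w' x = 2 \<and> removeAll x w' = removeAll x w"
    if w': "w' = ?u \<or> w' = ?d" for w'
  proof -
    have eq: "removeAll x w' = removeAll x w" using w' w by auto
    have c: "count_list w' x = 2" "count_list w' y = 2" using w' xy y(1) by (auto simp: count_list_0_iff)
    have "x \<in> set w" using w by simp
    have "x \<notin> set (P @ A) \<union> set (B @ C @ y # D @ Q)" "x \<notin> set (P @ A @ y # B @ C) \<union> set (D @ Q)"
      using xy y(1) by auto
    moreover have "?u = (P @ A) @ x # y # x # (B @ C @ y # D @ Q)"
      "?d = (P @ A @ y # B @ C) @ x # y # x # (D @ Q)" by simp_all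
    ultimately obtain L R where LR: "w' = L @ x # y # x # R" "x \<notin> set L \<union> set R"
      using w' by metis
    have "represents_on w' V E"
      by (rule relocate_represents_on[OF rep y(2,1) leaf LR c(2) eq \<open>x \<in> set w\<close>])
    with eq c show ?thesis by simp
  qed
  have "f x \<noteq> f y" using inj y(1) V w by (auto dest: inj_onD)
  then consider "f x < f y" | "f y < f x" "\<tau> = [1, 2, 3]" | "f y < f x" "\<tau> = [1, 3, 2]"
    using \<tau> by fastforce
  then show thesis
  proof cases
    case 1
    show thesis
      by (rule that[OF inj relocate_up[OF \<tau> w xy av 1]]) (use * in blast)+
  next
    case 2
    show thesis
      by (rule that[OF inj, of ?d])
        (use * relocate_down_123[OF w xy _ 2(1)] av 2(2) in blast)+
  next
    case 3
    define g where "g = (\<lambda>z. if z = x then 2 * f y + 1 else 2 * f z)"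
    have "inj_on g V"
      using inj unfolding inj_on_def g_def by (auto, presburger+)
    moreover have "avoids (map g ?u) \<tau>"
      using relocate_down_132[OF w xy _ _ 3(1)] av inj V 3(2) unfolding g_def by blast
    ultimately show thesis
      by (rule that) (use * in blast)+
  qed
qed

text \<open>Induction on the length of the word, since each relocation shortens it. The hypothesis
  \<open>conn\<close> expresses connectivity: a nonempty set of vertices that no edge leaves is
  everything.\<close>

lemma two_uniform_if_no_single_letter:
  fixes f :: "'a \<Rightarrow> nat"
  assumes \<tau>: "\<tau> \<in> {[1, 2, 3], [1, 3, 2]}"
    and conn: "\<And>S. S \<subseteq> V \<Longrightarrow> S \<noteq> {} \<Longrightarrow> (\<And>u v. u \<in> S \<Longrightarrow> v \<in> V \<Longrightarrow> u \<noteq> v \<Longrightarrow> (u, v) \<in> E \<Longrightarrow> v \<in> S) \<Longrightarrow> S = V"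
    and "avoids (map f w) \<tau>" "inj_on f V" "represents_on w V E" "\<forall>x\<in>V. 2 \<le> count_list w x"
  shows "\<exists>(g :: 'a \<Rightarrow> nat) w'. inj_on g V \<and> avoids (map g w') \<tau> \<and> represents_on w' V E \<and> two_uniform w'"
  using assms(3-)
proof (induction "length w" arbitrary: f w rule: less_induct)
  case less
  note av = less.prems(1) and inj = less.prems(2) and rep = less.prems(3) and two = less.prems(4)
  have V: "set w = V" using rep by (simp add: represents_on_def)
  then have injw: "inj_on f (set w)" using inj by simp
  have adj: "alternate w u v \<longleftrightarrow> (u, v) \<in> E" if "u \<in> V" "v \<in> V" "u \<noteq> v" for u v
    using rep that by (simp add: represents_on_def)
  show ?case
  proof (cases "two_uniform w")
    case True
    then show ?thesis using av inj rep by blast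
  next
    case False
    then obtain x where x: "x \<in> V" "3 \<le> count_list w x"
      using two V by (force simp: two_uniform_def)
    show ?thesis
    proof (cases "V = {x}")
      case True
      have "represents_on [x, x] V E" "two_uniform [x, x]"
        using True by (auto simp: represents_on_def two_uniform_def)
      moreover have "avoids (map f [x, x]) \<tau>"
        by (rule avoids_map_if_two_letters[OF \<tau>, of _ x x]) simp
      ultimately show ?thesis using inj by blast
    next
      case False
      \<comment> \<open>By connectivity some edge leaves \<open>{x}\<close>.\<close>
      then obtain y where y: "y \<in> V" "x \<noteq> y" "alternate w x y"
        using conn[of "{x}"] x(1) adj by blast
      have leaf_x: "z = y" if "z \<noteq> x" "alternate w x z" for z
        using leaf_if_three_occurrences[OF \<tau> av injw x(2) y(2) _ y(3) that(2)] that(1) by simp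
      show ?thesis
      proof (cases "count_list w y = 2")
        case True
        obtain g w' where g: "inj_on (g :: 'a \<Rightarrow> nat) V" "avoids (map g w') \<tau>" "represents_on w' V E"
          and w': "count_list w' x = 2" "removeAll x w' = removeAll x w"
          using relocate_leaf[OF \<tau> av inj rep x(2) y(2,3) True] by metis
        have len: "length u = length (removeAll x u) + count_list u x" for u
          by (induction u) auto
        have cnt: "count_list u z = count_list (removeAll x u) z" if "z \<noteq> x" for u z
          using that by (induction u) auto
        have "length w' < length w" using len[of w'] len[of w] w' x(2) by simp
        moreover have "\<forall>z\<in>V. 2 \<le> count_list w' z"
          using two cnt w' by (metis order_refl)
        ultimately show ?thesis using less.hyps g by blast
      next
        case False
        then have "3 \<le> count_list w y" using two y(1) by force
        then have leaf_y: "z = x" if "z \<noteq> y" "alternate w y z" for z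
          using leaf_if_three_occurrences[OF \<tau> av injw _ y(2)[symmetric] _ _ that(2)] that(1) y(3)
          by (simp add: alternate_commute[of w y x] \<open>3 \<le> count_list w y\<close>)
        \<comment> \<open>Now \<open>x\<close> and \<open>y\<close> are each other's only
          neighbours, so no edge leaves \<open>{x, y}\<close> and the word \<open>xyxy\<close>
          suffices.\<close>
        have xy: "{x, y} = V"
        proof (rule conn)
          fix u v assume "u \<in> {x, y}" "v \<in> V" "u \<noteq> v" "(u, v) \<in> E"
          then show "v \<in> {x, y}" using x(1) y(1) leaf_x[of v] leaf_y[of v] adj[of u v] by blast
        qed (use x(1) y(1) in auto)
        have "alternate [x, y, x, y] x y"
          using y(2) by (simp add: alternate_iff_distinct_adj)
        then have "represents_on [x, y, x, y] V E" 
          using y(1,2) adj xy x(1) y(3) alternate_commute[of w y x] unfolding represents_on_def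
          by (auto simp: alternate_commute[of "[x, y, x, y]" y x])
        moreover have "two_uniform [x, y, x, y]" using y(2) by (simp add: two_uniform_def)
        moreover have "avoids (map f [x, y, x, y]) \<tau>"
          by (rule avoids_map_if_two_letters[OF \<tau>, of _ x y]) simp
        ultimately show ?thesis using inj by blast
      qed
    qed
  qed
qed

subsection \<open>Disjoint unions and components\<close>

definition representable_on :: "nat list \<Rightarrow> 'a set \<Rightarrow> ('a \<times> 'a) set \<Rightarrow> bool" where
  "representable_on \<tau> V E \<longleftrightarrow>
     (\<exists>(f :: 'a \<Rightarrow> nat) w. inj_on f V \<and> represents_on w V E \<and> avoids (map f w) \<tau>)"

definition two_uniform_representable_on :: "nat list \<Rightarrow> 'a set \<Rightarrow> ('a \<times> 'a) set \<Rightarrow> bool" where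
  "two_uniform_representable_on \<tau> V E \<longleftrightarrow>
     (\<exists>(f :: 'a \<Rightarrow> nat) w. inj_on f V \<and> represents_on w V E \<and> two_uniform w \<and> avoids (map f w) \<tau>)"

lemma avoids_map_subseq:
  assumes "avoids (map f w) \<tau>" "subseq v w"
  shows "avoids (map f v) \<tau>"
  using assms subseq_map[of v w f] unfolding avoids_def by (metis subseq_order.order_trans)

text \<open>The word is \<open>v @ w\<close> with every label on \<open>V\<close> above every label
  on \<open>W\<close>. Only \<open>w\<close> has to be 2-uniform: its factor \<open>yy\<close> after
  removal of other letters already prevents alternation with letters of \<open>V\<close>.\<close>

lemma representable_on_Un:
  assumes \<tau>: "\<tau> \<in> {[1, 2, 3], [1, 3, 2]}"
    and V: "representable_on \<tau> V E" and W: "two_uniform_representable_on \<tau> W E"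
    and disj: "V \<inter> W = {}" and E: "\<And>v w. v \<in> V \<Longrightarrow> w \<in> W \<Longrightarrow> (v, w) \<notin> E \<and> (w, v) \<notin> E"
  shows "representable_on \<tau> (V \<union> W) E"
proof -
  obtain f :: "'a \<Rightarrow> nat" and v where f: "inj_on f V" "represents_on v V E" "avoids (map f v) \<tau>"
    using V by (auto simp: representable_on_def)
  obtain g :: "'a \<Rightarrow> nat" and w where g: "inj_on g W" "represents_on w W E" "two_uniform w" "avoids (map g w) \<tau>"
    using W by (auto simp: two_uniform_representable_on_def)
  have sets: "set v = V" "set w = W" using f g by (simp_all add: represents_on_def)
  \<comment> \<open>Shifting by \<open>N\<close> lifts the labels of \<open>V\<close> above those of
    \<open>W\<close>; the inserted 0 covers an empty \<open>W\<close>.\<close>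
  define N where "N = Suc (Max (insert 0 (g ` W)))"
  have N: "g x < N" if "x \<in> W" for x
    using that sets(2) by (auto simp: N_def less_Suc_eq_le intro!: Max_ge)
  define h where "h = (\<lambda>x. if x \<in> V then f x + N else g x)"
  have hV: "h x = f x + N" if "x \<in> V" for x using that by (simp add: h_def)
  have hW: "h x = g x" if "x \<in> W" for x using that disj by (auto simp: h_def)
  have h: "h y < h x" if "x \<in> V" "y \<in> W" for x y
    using that N[of y] by (simp add: hV hW)
  have "inj_on h (V \<union> W)"
  proof (rule inj_onI)
    fix x y assume "x \<in> V \<union> W" "y \<in> V \<union> W" "h x = h y"
    then show "x = y" using f(1) g(1) h[of x y] h[of y x] by (auto simp: hV hW dest: inj_onD)
  qed
  moreover have "represents_on (v @ w) (V \<union> W) E"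
  proof -
    have vv: "alternate (v @ w) x y \<longleftrightarrow> alternate v x y" if "x \<in> V" "y \<in> V" "x \<noteq> y" for x y
    proof -
      have "filter (\<lambda>z. z = x \<or> z = y) w = []" using that disj sets by (auto simp: filter_empty_conv)
      then show ?thesis using that by (simp add: alternate_iff_distinct_adj)
    qed
    have ww: "alternate (v @ w) x y \<longleftrightarrow> alternate w x y" if "x \<in> W" "y \<in> W" "x \<noteq> y" for x y
    proof -
      have "filter (\<lambda>z. z = x \<or> z = y) v = []" using that disj sets by (auto simp: filter_empty_conv)
      then show ?thesis using that by (simp add: alternate_iff_distinct_adj)
    qed
    have vw: "\<not> alternate (v @ w) x y" if "x \<in> V" "y \<in> W" for x y
    proof -
      have xw: "x \<notin> set w" and xy: "x \<noteq> y" and y: "count_list w y = 2"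
        using that disj sets g(3) by (auto simp: two_uniform_def)
      have "filter (\<lambda>z. z = x \<or> z = y) w = filter (\<lambda>z. z = y) w" using xw by (auto intro: filter_cong)
      also have "\<dots> = replicate (count_list w y) y" by (induction w) auto
      also have "\<dots> = [y, y]" using y by (simp add: numeral_2_eq_2)
      finally show ?thesis using xy by (simp add: alternate_iff_distinct_adj distinct_adj_append_iff)
    qed
    have "alternate (v @ w) x y \<longleftrightarrow> (x, y) \<in> E" if xy: "x \<in> V \<union> W" "y \<in> V \<union> W" "x \<noteq> y" for x y
    proof -
      consider "x \<in> V" "y \<in> V" | "x \<in> W" "y \<in> W" | "x \<in> V" "y \<in> W" | "x \<in> W" "y \<in> V"
        using xy(1,2) by blast
      then show ?thesis
      proof cases
        case 1
        then show ?thesis using vv xy(3) f(2) by (simp add: represents_on_def)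
      next
        case 2
        then show ?thesis using ww xy(3) g(2) by (simp add: represents_on_def)
      next
        case 3
        then show ?thesis using vw E by blast
      next
        case 4
        then show ?thesis using vw E alternate_commute by metis
      qed
    qed
    then show ?thesis using sets by (simp add: represents_on_def)
  qed
  moreover have "avoids (map h (v @ w)) \<tau>"
  proof -
    have len: "length \<tau> = 3" using \<tau> by auto
    \<comment> \<open>Both patterns start with their least entry, whereas a triple meeting both
      words starts in \<open>v\<close> and contains a lower label from \<open>w\<close>.\<close>
    have iso: "p < q \<and> p < r" if "order_isomorphic [p, q, r] \<tau>" for p q r :: nat
      using \<tau> that by (auto simp: order_isomorphic_3)
    have av: "avoids (map h v) \<tau>" "avoids (map h w) \<tau>"
      using f(3) g(4) sets unfolding avoids_map_iff[OF len]
    proof -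
      assume f: "\<forall>a b c. subseq [a, b, c] v \<longrightarrow> \<not> order_isomorphic [f a, f b, f c] \<tau>"
      have "order_isomorphic [p + N, q + N, r + N] \<tau> \<longleftrightarrow> order_isomorphic [p, q, r] \<tau>" for p q r
        using \<tau> by (auto simp: order_isomorphic_3)
      then show "\<forall>a b c. subseq [a, b, c] v \<longrightarrow> \<not> order_isomorphic [h a, h b, h c] \<tau>"
        using f sets(1) hV subseq_3_imp_set by metis
    next
      assume g: "\<forall>a b c. subseq [a, b, c] w \<longrightarrow> \<not> order_isomorphic [g a, g b, g c] \<tau>"
      then show "\<forall>a b c. subseq [a, b, c] w \<longrightarrow> \<not> order_isomorphic [h a, h b, h c] \<tau>"
        using sets(2) hW subseq_3_imp_set by metis
    qed
    have "\<not> order_isomorphic [h a, h b, h c] \<tau>" if "subseq [a, b, c] (v @ w)" for a b c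
    proof
      assume o: "order_isomorphic [h a, h b, h c] \<tau>"
      have "a \<in> V \<and> (b \<in> W \<or> c \<in> W)"
        if "\<not> subseq [a, b, c] v" "\<not> subseq [a, b, c] w"
        using \<open>subseq [a, b, c] (v @ w)\<close> that sets subseq_2_imp_set
        unfolding subseq_append_3 by metis
      then show False using o iso[OF o] h av unfolding avoids_map_iff[OF len] by (meson order.asym)
    qed
    then show ?thesis unfolding avoids_map_iff[OF len] by blast
  qed
  ultimately show ?thesis unfolding representable_on_def by blast
qed

text \<open>The set \<open>V\<close>, whose word need not be 2-uniform, absorbs the members of
  \<open>F\<close> one by one. The last hypothesis says that no edge crosses the boundary of a
  member.\<close>

lemma representable_on_Union:
  assumes \<tau>: "\<tau> \<in> {[1, 2, 3], [1, 3, 2]}" and "finite F" and "representable_on \<tau> V E"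
    and "\<And>W. W \<in> F \<Longrightarrow> two_uniform_representable_on \<tau> W E" "\<And>W. W \<in> F \<Longrightarrow> V \<inter> W = {}"
    and "disjoint F" "\<And>W u v. W \<in> F \<Longrightarrow> (u, v) \<in> E \<Longrightarrow> u \<in> W \<longleftrightarrow> v \<in> W"
  shows "representable_on \<tau> (V \<union> \<Union>F) E"
  using assms(2,4-)
proof (induction F rule: finite_induct)
  case empty
  then show ?case using assms(3) by simp
next
  case (insert W F)
  have "representable_on \<tau> (V \<union> \<Union>F) E"
    using insert by (auto simp: pairwise_insert)
  moreover have disj: "(V \<union> \<Union>F) \<inter> W = {}"
    using insert.prems(2,3) insert.hyps(2) by (auto simp: pairwise_insert disjnt_def)
  moreover have "two_uniform_representable_on \<tau> W E" using insert.prems(1) by blast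
  moreover have "(v, w) \<notin> E \<and> (w, v) \<notin> E" if "v \<in> V \<union> \<Union>F" "w \<in> W" for v w
    using that disj insert.prems(4)[of W] by blast
  ultimately have "representable_on \<tau> ((V \<union> \<Union>F) \<union> W) E"
    using representable_on_Un[OF \<tau>] by blast
  then show ?case by (simp add: Un_ac)
qed

section \<open>Connected components of a symmetric digraph\<close>

lemma (in graph) arcs_ends_scc:
  assumes "H \<in> sccs" "u \<in> verts H" "v \<in> verts H"
  shows "(u, v) \<in> arcs_ends H \<longleftrightarrow> (u, v) \<in> arcs_ends G"
proof -
  have "induced_subgraph H G" using assms(1) by (rule in_sccs_imp_induced)
  then have "arcs H = {e \<in> arcs G. tail G e \<in> verts H \<and> head G e \<in> verts H}"
    "tail H = tail G" "head H = head G"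
    by (auto simp: induced_subgraph_def subgraph_def compatible_def)
  then show ?thesis using assms(2,3) by (auto simp: arcs_ends_conv)
qed

lemma (in graph) represents_scc_iff:
  assumes "H \<in> sccs"
  shows "represents w H \<longleftrightarrow> represents_on w (verts H) (arcs_ends G)"
  using arcs_ends_scc[OF assms] by (auto simp: represents_def represents_on_def)

text \<open>By symmetry the ends of an arc are mutually reachable, and a strong component is closed
  under mutual reachability.\<close>

lemma (in graph) arc_in_scc_iff:
  assumes "H \<in> sccs" "(u, v) \<in> arcs_ends G"
  shows "u \<in> verts H \<longleftrightarrow> v \<in> verts H"
proof -
  have "verts H \<in> sccs_verts" using assms(1) sccs_verts_conv by blast
  moreover have "u \<rightarrow>\<^sup>* v" using assms(2) by (rule reachable_adjI)
  moreover from this have "v \<rightarrow>\<^sup>* u" using sym_arcs by (rule symmetric_reachable[rotated])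
  ultimately show ?thesis unfolding in_sccs_verts_conv_reachable by blast
qed

text \<open>Inside \<open>H\<close> every vertex is reachable from a vertex of \<open>S\<close>, and
  closedness carries membership along the path. This supplies the connectivity hypothesis
  \<open>conn\<close>.\<close>

lemma (in graph) scc_closed_imp_eq:
  assumes "H \<in> sccs" "S \<subseteq> verts H" "S \<noteq> {}"
    and closed: "\<And>u v. u \<in> S \<Longrightarrow> v \<in> verts H \<Longrightarrow> u \<noteq> v \<Longrightarrow> (u, v) \<in> arcs_ends G \<Longrightarrow> v \<in> S"
  shows "S = verts H"
proof -
  obtain u where u: "u \<in> S" using assms(3) by blast
  interpret H: wf_digraph H
    using in_sccs_imp_induced[OF assms(1)] by (rule wf_digraphI_induced)
  have "v \<in> S" if "v \<in> verts H" for v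
  proof -
    have "u \<rightarrow>\<^sup>*\<^bsub>H\<^esub> v" using assms(1,2) u that by (auto simp: sccs_def strongly_connected_def)
    then show ?thesis
    proof (induction rule: H.reachable_induct)
      case base
      show ?case by (fact u)
    next
      case (step x y)
      then have "x \<in> verts H" "y \<in> verts H" by (auto simp: H.adj_in_verts)
      then have "(x, y) \<in> arcs_ends G" using step arcs_ends_scc[OF assms(1)] by blast
      then show ?case using closed step \<open>y \<in> verts H\<close> by metis
    qed
  qed
  then show ?thesis using assms(2) by blast
qed

text \<open>Restricting \<open>w\<close> to the letters of \<open>H\<close> keeps counts,
  alternation and avoidance. If all these letters occurred at least twice, the restriction could be
  turned into a 2-uniform word.\<close>

lemma (in graph) single_letter_in_scc:
  fixes f :: "'a \<Rightarrow> nat"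
  assumes \<tau>: "\<tau> \<in> {[1, 2, 3], [1, 3, 2]}" and H: "H \<in> sccs" "\<not> two_uniform_representable \<tau> H"
    and w: "inj_on f (verts G)" "represents w G" "avoids (map f w) \<tau>"
  shows "\<exists>x\<in>verts H. count_list w x \<le> 1"
proof (rule ccontr)
  assume two: "\<not> ?thesis"
  define v where "v = filter (\<lambda>z. z \<in> verts H) w"
  have sub: "verts H \<subseteq> verts G"
    using in_sccs_imp_induced[OF H(1)] by (auto simp: induced_subgraph_def subgraph_def)
  have "set v = verts H" using w(2) sub by (auto simp: v_def represents_def)
  moreover have "alternate v x y \<longleftrightarrow> alternate w x y" if "x \<in> verts H" "y \<in> verts H" "x \<noteq> y" for x y
    using that unfolding v_def by (intro alternate_filter)
  ultimately have rep: "represents_on v (verts H) (arcs_ends G)"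
    using w(2) sub by (auto simp: represents_on_def represents_def subset_iff)
  have "count_list v x = count_list w x" if "x \<in> verts H" for x
    unfolding v_def using that by (induction w) auto
  then have count: "\<forall>x\<in>verts H. 2 \<le> count_list v x" using two by force
  have av: "avoids (map f v) \<tau>"
    using w(3) by (rule avoids_map_subseq) (simp add: v_def)
  have inj: "inj_on f (verts H)" using w(1) sub by (rule inj_on_subset)
  have "\<exists>(g :: 'a \<Rightarrow> nat) w'. inj_on g (verts H) \<and> avoids (map g w') \<tau> \<and>
      represents_on w' (verts H) (arcs_ends G) \<and> two_uniform w'"
    by (rule two_uniform_if_no_single_letter[OF \<tau> _ av inj rep count])
      (rule scc_closed_imp_eq[OF H(1)])
  then show False
    using H unfolding two_uniform_representable_def represents_scc_iff[OF H(1)] by blast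
qed

lemma alternate_if_single:
  assumes "count_list w x \<le> 1" "count_list w y \<le> 1"
  shows "alternate w x y"
  using assms by (auto simp: alternate_iff_factors)

theorem theorem4p1:
  fixes G :: "('a, 'b) pre_digraph" and \<tau> :: "nat list"
  assumes "\<tau> \<in> {[1, 2, 3], [1, 3, 2]}"
    and "graph G"
    and "\<forall>H \<in> pre_digraph.sccs G. representable \<tau> H"
  shows "representable \<tau> G \<longleftrightarrow>
    card {H \<in> pre_digraph.sccs G. \<not> two_uniform_representable \<tau> H} \<le> 1"
proof -
  interpret graph G by (fact assms(2))
  let ?E = "arcs_ends G" and ?B = "{H \<in> sccs. \<not> two_uniform_representable \<tau> H}"
  \<comment> \<open>Finiteness matters because \<open>card\<close> is 0 on infinite sets.\<close>
  have fin: "finite sccs"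
    using finite_sccs_verts inj_on_verts_sccs by (simp add: sccs_verts_conv finite_image_iff)
  then have card: "card ?B \<le> 1 \<longleftrightarrow> (\<forall>H\<in>?B. \<forall>K\<in>?B. H = K)"
    using card_le_Suc0_iff_eq[of ?B] by simp
  have rep: "representable_on \<tau> (verts H) ?E" if "H \<in> sccs" for H
    using assms(3) that
    unfolding representable_def representable_on_def represents_scc_iff[OF that, symmetric] by simp
  have two: "two_uniform_representable \<tau> H \<longleftrightarrow> two_uniform_representable_on \<tau> (verts H) ?E"
    if "H \<in> sccs" for H
    using represents_scc_iff[OF that]
    by (auto simp: two_uniform_representable_def two_uniform_representable_on_def)
  have repG: "representable \<tau> G \<longleftrightarrow> representable_on \<tau> (verts G) ?E"
    by (simp add: representable_def representable_on_def represents_def represents_on_def)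
  show ?thesis
  proof
    assume "representable \<tau> G"
    then obtain f :: "'a \<Rightarrow> nat" and w
      where w: "inj_on f (verts G)" "represents w G" "avoids (map f w) \<tau>"
      by (auto simp: representable_def)
    have "H = K" if HK: "H \<in> ?B" "K \<in> ?B" for H K
    proof (rule ccontr)
      assume "H \<noteq> K"
      then have disj: "verts H \<inter> verts K = {}" using HK scc_disj by blast
      have "\<exists>x\<in>verts L. count_list w x \<le> 1" if "L \<in> ?B" for L
        by (rule single_letter_in_scc[OF assms(1) _ _ w]) (use that in simp_all)
      from this[OF HK(1)] this[OF HK(2)] obtain x y
        where xy: "x \<in> verts H" "count_list w x \<le> 1" "y \<in> verts K" "count_list w y \<le> 1"
        by blast
      have "verts H \<subseteq> verts G" "verts K \<subseteq> verts G"
        using HK in_sccs_imp_induced by (auto simp: induced_subgraph_def subgraph_def)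
      then have "x \<in> verts G" "y \<in> verts G" "x \<noteq> y" using xy(1,3) disj by auto
      \<comment> \<open>Letters occurring once alternate, which produces an edge between two
        different components.\<close>
      then have "(x, y) \<in> ?E"
        using alternate_if_single[OF xy(2,4)] w(2) by (simp add: represents_def)
      then show False using arc_in_scc_iff[of H x y] HK xy(1,3) disj by blast
    qed
    then show "card ?B \<le> 1" unfolding card by blast
  next
    assume "card ?B \<le> 1"
    then have B: "\<forall>H\<in>?B. \<forall>K\<in>?B. H = K" unfolding card .
    \<comment> \<open>\<open>K\<close> consists of the exceptional component, or is empty if there
      is none; in that case \<open>V\<close> is empty and the empty word starts the union.\<close>
    obtain V K where V: "representable_on \<tau> V ?E" "V = \<Union>(verts ` K)" "K \<subseteq> sccs" "?B \<subseteq> K"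
    proof (cases "?B = {}")
      case True
      have "representable_on \<tau> {} ?E"
        unfolding representable_on_def represents_on_def avoids_def
        using assms(1) by (intro exI[of _ "\<lambda>_. 0"] exI[of _ "[]"]) (auto simp: order_isomorphic_def)
      then show thesis by (rule that[of _ "{}"]) (use True in auto)
    next
      case False
      then obtain H where "?B = {H}" using B by blast
      then show thesis by (intro that[of "verts H" "{H}"] rep) auto
    qed
    let ?F = "verts ` (sccs - K)"
    have disj: "verts H \<inter> verts L = {}" if "H \<in> sccs" "L \<in> sccs" "H \<noteq> L" for H L
      using that scc_disj by blast
    have "representable_on \<tau> (V \<union> \<Union>?F) ?E"
    proof (rule representable_on_Union[OF assms(1) _ V(1)])
      show "finite ?F" using fin by simp
      show "disjoint ?F" using disj by (auto simp: pairwise_def disjnt_def)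
      fix W assume "W \<in> ?F"
      then obtain H where H: "H \<in> sccs" "H \<notin> K" "W = verts H" by blast
      then show "two_uniform_representable_on \<tau> W ?E" using V(4) two by blast
      show "V \<inter> W = {}" using H V(2,3) disj by blast
      show "u \<in> W \<longleftrightarrow> v \<in> W" if "(u, v) \<in> ?E" for u v
        using arc_in_scc_iff[OF H(1) that] H(3) by simp
    qed
    moreover have "V \<union> \<Union>?F = verts G"
    proof -
      have "verts G \<subseteq> \<Union>sccs_verts"
        using in_scc_of_self by (auto simp: sccs_verts_conv_scc_of)
      moreover have "\<Union>sccs_verts \<subseteq> verts G" using sccs_verts_subsets by blast
      ultimately have "\<Union>(verts ` sccs) = verts G" by (simp add: sccs_verts_conv)
      then show ?thesis using V(2,3) by blast
    qed
    ultimately show "representable \<tau> G" using repG by simp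
  qed
qed

end
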